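(* Let $\Gamma$ and $\Gamma'$ be finite simple graphs. Then $\Gamma$ is isomorphic to $\Gamma'$ if and only if the monoids $\operatorname{MR}(\Gamma)$ and $\operatorname{MR}(\Gamma')$ are isomorphic.
   Context: For a finite simple graph $\Gamma=(V,E)$, the simplices are the singletons $\{v\}$, $v\in V$, and the edges. The Margolis-Rhodes monoid $\operatorname{MR}(\Gamma)$ is the monoid of all partial functions $f:V\to V$ (acting on the right, composed left to right) such that for every simplex $\sigma$ the full preimage $\sigma f^{-1}=\{v\in\operatorname{Dom}(f)\mid vf\in\sigma\}$ is a simplex or empty. Isomorphism of monoids is as abstract monoids. *)

theory Defs
  imports
    "HOL-Algebra.Group"
    "Graph_Theory.Pair_Digraph"
    "Graph_Theory.Digraph_Isomorphism"
begin

text \<open>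
  A finite simple graph is a structure satisfying the locale predicate
  \<open>pair_graph\<close> of Graph_Theory: finitely many vertices and a
  symmetric irreflexive relation \<open>parcs\<close> on them, so that the undirected edge
  \<open>{u, v}\<close> is represented by the two arcs \<open>(u, v)\<close> and \<open>(v, u)\<close>.
  The graph without vertices is allowed.
\<close>

definition simplex :: "'a pair_pre_digraph \<Rightarrow> 'a set \<Rightarrow> bool" where
  "simplex G \<sigma> \<longleftrightarrow>
     (\<exists>v \<in> pverts G. \<sigma> = {v}) \<or> (\<exists>u v. (u, v) \<in> parcs G \<and> \<sigma> = {u, v})"

definition preimage :: "('a \<rightharpoonup> 'a) \<Rightarrow> 'a set \<Rightarrow> 'a set" where
  "preimage f \<sigma> = {v \<in> dom f. the (f v) \<in> \<sigma>}"

definition MR_carrier :: "'a pair_pre_digraph \<Rightarrow> ('a \<rightharpoonup> 'a) set" where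
  "MR_carrier G =
     {f. dom f \<subseteq> pverts G \<and> ran f \<subseteq> pverts G \<and>
         (\<forall>\<sigma>. simplex G \<sigma> \<longrightarrow> simplex G (preimage f \<sigma>) \<or> preimage f \<sigma> = {})}"

text \<open>
  Maps act on the right, so the product \<open>f g\<close> applies \<open>f\<close> first; since
  \<open>\<circ>\<^sub>m\<close> applies its right argument first, the order is reversed below.
\<close>

definition MR :: "'a pair_pre_digraph \<Rightarrow> ('a \<rightharpoonup> 'a) monoid" where
  "MR G = \<lparr>carrier = MR_carrier G, monoid.mult = (\<lambda>f g. g \<circ>\<^sub>m f), one = Some |` pverts G\<rparr>"

lemma preimage_map_comp: "preimage (g \<circ>\<^sub>m f) \<sigma> = preimage f (preimage g \<sigma>)"
  by (auto simp: preimage_def map_comp_def dom_def split: option.splits)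

lemma preimage_empty: "preimage f {} = {}"
  by (simp add: preimage_def)

lemma simplex_subset:
  assumes "pair_wf_digraph G" "simplex G \<sigma>"
  shows "\<sigma> \<subseteq> pverts G"
  using assms pair_wf_digraph.in_arcsD1[of G] pair_wf_digraph.in_arcsD2[of G]
  unfolding simplex_def by blast

lemma monoid_MR:
  assumes "pair_wf_digraph G"
  shows "monoid (MR G)"
proof (rule monoidI)
  fix f g assume fg: "f \<in> carrier (MR G)" "g \<in> carrier (MR G)"
  have "dom (g \<circ>\<^sub>m f) \<subseteq> dom f" "ran (g \<circ>\<^sub>m f) \<subseteq> ran g"
    by (auto simp: map_comp_def dom_def ran_def split: option.splits)
  with fg show "f \<otimes>\<^bsub>MR G\<^esub> g \<in> carrier (MR G)"
    by (simp add: MR_def MR_carrier_def preimage_map_comp) (metis order.trans preimage_empty)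
next
  have "preimage (Some |` pverts G) \<sigma> = \<sigma>" if "simplex G \<sigma>" for \<sigma>
    using simplex_subset[OF assms that] by (auto simp: preimage_def restrict_map_def dom_def)
  then show "\<one>\<^bsub>MR G\<^esub> \<in> carrier (MR G)"
    by (auto simp: MR_def MR_carrier_def restrict_map_def ran_def dom_def split: if_splits)
next
  fix f g h
  show "f \<otimes>\<^bsub>MR G\<^esub> g \<otimes>\<^bsub>MR G\<^esub> h = f \<otimes>\<^bsub>MR G\<^esub> (g \<otimes>\<^bsub>MR G\<^esub> h)"
    by (auto simp: MR_def map_comp_def fun_eq_iff split: option.splits)
next
  fix f assume "f \<in> carrier (MR G)"
  then have "dom f \<subseteq> pverts G" by (simp add: MR_def MR_carrier_def)
  then have "f x = None" if "x \<notin> pverts G" for x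
    using that by (auto simp: dom_def)
  then show "\<one>\<^bsub>MR G\<^esub> \<otimes>\<^bsub>MR G\<^esub> f = f"
    by (auto simp: MR_def map_comp_def fun_eq_iff restrict_map_def)
next
  fix f assume "f \<in> carrier (MR G)"
  then show "f \<otimes>\<^bsub>MR G\<^esub> \<one>\<^bsub>MR G\<^esub> = f"
    by (auto simp: MR_def MR_carrier_def map_comp_def fun_eq_iff restrict_map_def ran_def
        split: option.splits)
qed

text \<open>
  For graphs embedded via \<open>with_proj\<close>, the library's \<open>digraph_iso\<close>, which also
  carries maps for arcs, heads and tails, is isomorphism of simple graphs.
\<close>

lemma digraph_iso_with_proj_iff:
  assumes G: "pair_wf_digraph G" and H: "pair_wf_digraph H"
  shows "digraph_iso (with_proj G) (with_proj H) \<longleftrightarrow>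
    (\<exists>\<phi>. bij_betw \<phi> (pverts G) (pverts H) \<and>
         (\<forall>u \<in> pverts G. \<forall>v \<in> pverts G. (u, v) \<in> parcs G \<longleftrightarrow> (\<phi> u, \<phi> v) \<in> parcs H))"
    (is "?L \<longleftrightarrow> ?R")
proof
  assume ?L
  then obtain f where f: "pre_digraph.digraph_isomorphism (with_proj G) f"
    and eq: "with_proj H = app_iso f (with_proj G)"
    unfolding digraph_iso_def by blast
  from eq have HV: "pverts H = iso_verts f ` pverts G" and HA: "parcs H = iso_arcs f ` parcs G"
    and HT: "iso_tail f = fst" "iso_head f = snd"
    by (simp_all add: with_proj_def app_iso_def)
  let ?\<phi> = "iso_verts f"
  have arc: "iso_arcs f a = (?\<phi> (fst a), ?\<phi> (snd a))" if "a \<in> parcs G" for a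
    using f that by (auto simp: pre_digraph.digraph_isomorphism_def HT prod_eq_iff)
  have inj: "inj_on ?\<phi> (pverts G)"
    using f by (auto simp: pre_digraph.digraph_isomorphism_def)
  have "(u, v) \<in> parcs G \<longleftrightarrow> (?\<phi> u, ?\<phi> v) \<in> parcs H" if uv: "u \<in> pverts G" "v \<in> pverts G" for u v
  proof
    assume "(u, v) \<in> parcs G"
    then show "(?\<phi> u, ?\<phi> v) \<in> parcs H" using arc HA by force
  next
    assume "(?\<phi> u, ?\<phi> v) \<in> parcs H"
    then obtain a where a: "a \<in> parcs G" "(?\<phi> u, ?\<phi> v) = iso_arcs f a" using HA by auto
    with arc have "?\<phi> u = ?\<phi> (fst a)" "?\<phi> v = ?\<phi> (snd a)" by auto
    then have "u = fst a" "v = snd a"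
      using inj uv a(1) G by (auto dest: inj_onD pair_wf_digraph.arc_fst_in_verts
          pair_wf_digraph.arc_snd_in_verts)
    with a show "(u, v) \<in> parcs G" by simp
  qed
  with inj HV show ?R by (auto simp: bij_betw_def)
next
  assume ?R
  then obtain \<phi> where bij: "bij_betw \<phi> (pverts G) (pverts H)"
    and iff: "\<And>u v. u \<in> pverts G \<Longrightarrow> v \<in> pverts G \<Longrightarrow> (u, v) \<in> parcs G \<longleftrightarrow> (\<phi> u, \<phi> v) \<in> parcs H"
    by blast
  define f where "f = \<lparr>iso_verts = \<phi>, iso_arcs = map_prod \<phi> \<phi>, iso_head = snd, iso_tail = fst\<rparr>"
  have sub: "parcs G \<subseteq> pverts G \<times> pverts G" "parcs H \<subseteq> pverts H \<times> pverts H"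
    using G H by (auto dest: pair_wf_digraph.in_arcsD1 pair_wf_digraph.in_arcsD2)
  have injV: "inj_on \<phi> (pverts G)" and img: "pverts H = \<phi> ` pverts G"
    using bij by (auto simp: bij_betw_def)
  have "inj_on (map_prod \<phi> \<phi>) (parcs G)"
    using map_prod_inj_on[OF injV injV] sub(1) by (rule inj_on_subset)
  moreover have "map_prod \<phi> \<phi> ` parcs G = parcs H"
    using sub iff img by (auto 0 3 simp: image_iff)
  ultimately have "pre_digraph.digraph_isomorphism (with_proj G) f"
    and "with_proj H = app_iso f (with_proj G)"
    using G injV img
    by (auto simp: pre_digraph.digraph_isomorphism_def f_def wf_digraph_wp_iff)
  then show ?L unfolding digraph_iso_def by blast
qed

end

theory Submission
  imports Defs
begin

text \<open>
  An isomorphism \<open>\<phi>\<close> of graphs turns \<open>f\<close> into \<open>\<phi>\<^sup>-\<^sup>1 f \<phi>\<close>, and this conjugation is an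
  isomorphism of the monoids because \<open>\<phi>\<close> and its inverse pull simplices back to simplices.

  For the converse, the graph is read off from the maps of rank one. Such a map, written
  \<open>collapse \<sigma> b\<close> below, sends all of \<open>\<sigma>\<close> to the vertex \<open>b\<close>; being the preimage of the simplex
  \<open>{b}\<close>, its domain \<open>\<sigma>\<close> is a simplex, and all pairs of a simplex and a vertex
  occur. If there are vertices, these maps and the empty map form the least nonzero ideal: from any
  nonempty \<open>f\<close> with \<open>f v = w\<close> one gets \<open>collapse \<sigma> b\<close> by composing \<open>collapse \<sigma> v\<close>, \<open>f\<close> and
  \<open>collapse {w} b\<close>. So every isomorphism \<open>\<theta>\<close> preserves the maps of rank one
  (\<open>\<theta>_collapse\<close>).

  The product of \<open>collapse \<rho> v\<close> and \<open>collapse \<sigma> b\<close>, in this order, is nonempty exactly when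
  \<open>v \<in> \<sigma>\<close>. Hence the monoid knows the incidence between vertices and simplices: if \<open>\<phi> v\<close> is the
  value of \<open>\<theta> (collapse {v} v)\<close> and \<open>\<tau>\<close> is the domain of \<open>\<theta> (collapse \<sigma> b)\<close>, then \<open>v \<in> \<sigma>\<close> iff
  \<open>\<phi> v \<in> \<tau>\<close>. Taking singletons for \<open>\<sigma>\<close> shows that \<open>\<phi>\<close> is injective; taking an edge \<open>{u, v}\<close>
  shows that \<open>\<phi> u\<close> and \<open>\<phi> v\<close> are two distinct vertices of one simplex, so they are adjacent
  (\<open>injective_graph_hom\<close>). The inverse of \<open>\<theta>\<close> gives an injective homomorphism in the other
  direction, and by finiteness both are isomorphisms (\<open>graph_iso_if_injective_homs\<close>).
\<close>

section \<open>Graph isomorphisms induce monoid isomorphisms\<close>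

lemma MR_simps:
  "carrier (MR G) = MR_carrier G"
  "f \<otimes>\<^bsub>MR G\<^esub> g = g \<circ>\<^sub>m f"
  by (simp_all add: MR_def)

definition restr_fun :: "('a \<Rightarrow> 'b) \<Rightarrow> 'a set \<Rightarrow> 'a \<rightharpoonup> 'b" where
  "restr_fun \<phi> A = (Some \<circ> \<phi>) |` A"

text \<open>
  The notion \<open>preimage\<close> for partial maps between two different types, as needed for maps from
  one graph to another.
\<close>

definition inv_img :: "('a \<rightharpoonup> 'b) \<Rightarrow> 'b set \<Rightarrow> 'a set" where
  "inv_img f \<sigma> = {v. \<exists>w \<in> \<sigma>. f v = Some w}"

lemma preimage_eq_inv_img: "preimage f \<sigma> = inv_img f \<sigma>"
  by (auto simp: preimage_def inv_img_def dom_def)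

lemma inv_img_map_comp: "inv_img (g \<circ>\<^sub>m f) \<sigma> = inv_img f (inv_img g \<sigma>)"
  by (auto simp: inv_img_def map_comp_def split: option.splits)

lemma map_comp_assoc: "(h \<circ>\<^sub>m g) \<circ>\<^sub>m f = h \<circ>\<^sub>m (g \<circ>\<^sub>m f)"
  by (auto simp: map_comp_def fun_eq_iff split: option.splits)

text \<open>
  A graph isomorphism pulls simplices back to simplices, because it is onto: every simplex of
  \<open>H\<close> is the image of a simplex of \<open>G\<close>, and by injectivity that one is its preimage.
\<close>

lemma inv_img_restr_fun_simplex:
  assumes bij: "bij_betw \<phi> (pverts G) (pverts H)"
    and iff: "\<And>u v. u \<in> pverts G \<Longrightarrow> v \<in> pverts G \<Longrightarrow> (u, v) \<in> parcs G \<longleftrightarrow> (\<phi> u, \<phi> v) \<in> parcs H"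
    and H: "pair_wf_digraph H" and \<tau>: "simplex H \<tau>"
  shows "simplex G (inv_img (restr_fun \<phi> (pverts G)) \<tau>)"
proof -
  have inj: "inj_on \<phi> (pverts G)" and img: "\<phi> ` pverts G = pverts H"
    using bij by (auto simp: bij_betw_def)
  have image: "inv_img (restr_fun \<phi> (pverts G)) (\<phi> ` \<sigma>) = \<sigma>" if "\<sigma> \<subseteq> pverts G" for \<sigma>
    using that inj by (auto simp: inv_img_def restr_fun_def restrict_map_def dest: inj_onD)
  consider v where "v \<in> pverts H" "\<tau> = {v}" | u v where "(u, v) \<in> parcs H" "\<tau> = {u, v}"
    using \<tau> by (auto simp: simplex_def)
  then show ?thesis
  proof cases
    case 1
    then obtain v' where "v' \<in> pverts G" "\<tau> = \<phi> ` {v'}" using img by auto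
    then show ?thesis using image[of "{v'}"] by (auto simp: simplex_def)
  next
    case 2
    then have "u \<in> pverts H" "v \<in> pverts H"
      using H by (auto dest: pair_wf_digraph.in_arcsD1 pair_wf_digraph.in_arcsD2)
    then obtain u' v' where uv: "u' \<in> pverts G" "v' \<in> pverts G" "u = \<phi> u'" "v = \<phi> v'"
      using img by (metis imageE)
    then have "(u', v') \<in> parcs G" using 2 iff by auto
    moreover have "\<tau> = \<phi> ` {u', v'}" using 2 uv by auto
    ultimately show ?thesis
      using image[of "{u', v'}"] uv by (auto simp: simplex_def)
  qed
qed

text \<open>
  Preimages under a composite are computed in stages, so each of \<open>p\<close>, \<open>f\<close>, \<open>q\<close> may be treated
  on its own. The preimage under \<open>f\<close> may be empty, and then so is the whole one.
\<close>

lemma conj_MR_carrier: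
  assumes p: "dom p \<subseteq> pverts G" "ran p \<subseteq> pverts H" "\<And>\<tau>. simplex H \<tau> \<Longrightarrow> simplex G (inv_img p \<tau>)"
    and q: "dom q \<subseteq> pverts H" "ran q \<subseteq> pverts G" "\<And>\<sigma>. simplex G \<sigma> \<Longrightarrow> simplex H (inv_img q \<sigma>)"
    and f: "f \<in> MR_carrier G"
  shows "p \<circ>\<^sub>m f \<circ>\<^sub>m q \<in> MR_carrier H"
proof -
  have "dom (p \<circ>\<^sub>m f \<circ>\<^sub>m q) \<subseteq> dom q" "ran (p \<circ>\<^sub>m f \<circ>\<^sub>m q) \<subseteq> ran p"
    by (auto simp: map_comp_def dom_def ran_def split: option.splits)
  moreover have "inv_img q {} = {}" by (simp add: inv_img_def)
  moreover have "simplex H (inv_img q (inv_img f (inv_img p \<tau>))) \<or>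
      inv_img q (inv_img f (inv_img p \<tau>)) = {}" if "simplex H \<tau>" for \<tau>
  proof (cases "inv_img f (inv_img p \<tau>) = {}")
    case False
    then have "simplex G (inv_img f (inv_img p \<tau>))"
      using f p(3)[OF that] by (auto simp: MR_carrier_def preimage_eq_inv_img)
    then show ?thesis using q(3) by blast
  qed (simp add: \<open>inv_img q {} = {}\<close>)
  ultimately show ?thesis
    using p(2) q(1) by (simp add: MR_carrier_def preimage_eq_inv_img inv_img_map_comp) blast
qed

lemma map_comp_id_on:
  assumes "f \<in> MR_carrier G"
  shows "f \<circ>\<^sub>m (Some |` pverts G) = f" "(Some |` pverts G) \<circ>\<^sub>m f = f"
proof -
  have "f v = None" if "v \<notin> pverts G" for v using assms that by (auto simp: MR_carrier_def)
  moreover have "w \<in> pverts G" if "f v = Some w" for v w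
    using assms that by (auto simp: MR_carrier_def ran_def)
  ultimately show "f \<circ>\<^sub>m (Some |` pverts G) = f" "(Some |` pverts G) \<circ>\<^sub>m f = f"
    by (auto simp: map_comp_def restrict_map_def fun_eq_iff split: option.splits)
qed

text \<open>
  The isomorphism is conjugation with partial maps \<open>p\<close> and \<open>q\<close> that represent the graph
  isomorphism and its inverse: with \<open>q p\<close> and \<open>p q\<close> the identities of the two monoids,
  associativity of \<open>\<circ>\<^sub>m\<close> gives multiplicativity and bijectivity.
\<close>

lemma MR_iso_if_graph_iso:
  assumes G: "pair_wf_digraph G" and H: "pair_wf_digraph H"
    and bij: "bij_betw \<phi> (pverts G) (pverts H)"
    and iff: "\<And>u v. u \<in> pverts G \<Longrightarrow> v \<in> pverts G \<Longrightarrow> (u, v) \<in> parcs G \<longleftrightarrow> (\<phi> u, \<phi> v) \<in> parcs H"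
  shows "MR G \<cong> MR H"
proof -
  define \<psi> where "\<psi> = inv_into (pverts G) \<phi>"
  have bij': "bij_betw \<psi> (pverts H) (pverts G)"
    unfolding \<psi>_def using bij by (rule bij_betw_inv_into)
  have \<psi>\<phi>: "\<psi> (\<phi> u) = u" if "u \<in> pverts G" for u
    using that bij by (simp add: \<psi>_def bij_betw_inv_into_left)
  have \<phi>\<psi>: "\<phi> (\<psi> u) = u" if "u \<in> pverts H" for u
    using that bij by (simp add: \<psi>_def bij_betw_inv_into_right)
  have \<phi>V: "\<phi> u \<in> pverts H" if "u \<in> pverts G" for u using that bij by (auto simp: bij_betw_def)
  have \<psi>V: "\<psi> u \<in> pverts G" if "u \<in> pverts H" for u using that bij' by (auto simp: bij_betw_def)
  have iff': "(u, v) \<in> parcs H \<longleftrightarrow> (\<psi> u, \<psi> v) \<in> parcs G" if "u \<in> pverts H" "v \<in> pverts H" for u v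
    using iff[of "\<psi> u" "\<psi> v"] that by (simp add: \<phi>\<psi> \<psi>V)
  define p where "p = restr_fun \<phi> (pverts G)"
  define q where "q = restr_fun \<psi> (pverts H)"
  have p: "dom p \<subseteq> pverts G" "ran p \<subseteq> pverts H" "\<And>\<tau>. simplex H \<tau> \<Longrightarrow> simplex G (inv_img p \<tau>)"
    and q: "dom q \<subseteq> pverts H" "ran q \<subseteq> pverts G" "\<And>\<sigma>. simplex G \<sigma> \<Longrightarrow> simplex H (inv_img q \<sigma>)"
    using inv_img_restr_fun_simplex[OF bij iff H] inv_img_restr_fun_simplex[OF bij' iff' G] \<phi>V \<psi>V
    by (auto simp: p_def q_def restr_fun_def restrict_map_def ran_def dom_def split: if_splits)
  have qp: "q \<circ>\<^sub>m p = Some |` pverts G" and pq: "p \<circ>\<^sub>m q = Some |` pverts H"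
    using \<phi>V \<psi>V \<phi>\<psi> \<psi>\<phi>
    by (auto simp: p_def q_def restr_fun_def restrict_map_def map_comp_def fun_eq_iff)
  define \<theta> where "\<theta> f = p \<circ>\<^sub>m f \<circ>\<^sub>m q" for f
  define \<eta> where "\<eta> f = q \<circ>\<^sub>m f \<circ>\<^sub>m p" for f
  have \<theta>C: "\<theta> f \<in> MR_carrier H" if "f \<in> MR_carrier G" for f
    unfolding \<theta>_def using p q that by (rule conj_MR_carrier)
  have \<eta>C: "\<eta> f \<in> MR_carrier G" if "f \<in> MR_carrier H" for f
    unfolding \<eta>_def using q p that by (rule conj_MR_carrier)
  have \<eta>\<theta>: "\<eta> (\<theta> f) = f" if "f \<in> MR_carrier G" for f
  proof -
    have "\<eta> (\<theta> f) = (q \<circ>\<^sub>m p) \<circ>\<^sub>m (f \<circ>\<^sub>m (q \<circ>\<^sub>m p))" by (simp add: \<eta>_def \<theta>_def map_comp_assoc)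
    then show ?thesis using that by (simp add: qp map_comp_id_on)
  qed
  have \<theta>\<eta>: "\<theta> (\<eta> f) = f" if "f \<in> MR_carrier H" for f
  proof -
    have "\<theta> (\<eta> f) = (p \<circ>\<^sub>m q) \<circ>\<^sub>m (f \<circ>\<^sub>m (p \<circ>\<^sub>m q))" by (simp add: \<eta>_def \<theta>_def map_comp_assoc)
    then show ?thesis using that by (simp add: pq map_comp_id_on)
  qed
  have mult: "\<theta> (g \<circ>\<^sub>m f) = \<theta> g \<circ>\<^sub>m \<theta> f" if "f \<in> MR_carrier G" for f g
  proof -
    have "\<theta> g \<circ>\<^sub>m \<theta> f = p \<circ>\<^sub>m (g \<circ>\<^sub>m (((q \<circ>\<^sub>m p) \<circ>\<^sub>m f) \<circ>\<^sub>m q))" by (simp add: \<theta>_def map_comp_assoc)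
    also have "\<dots> = \<theta> (g \<circ>\<^sub>m f)" using that by (simp add: qp map_comp_id_on \<theta>_def map_comp_assoc)
    finally show ?thesis ..
  qed
  have "bij_betw \<theta> (MR_carrier G) (MR_carrier H)"
    by (rule bij_betw_byWitness[where f' = \<eta>]) (auto simp: \<eta>\<theta> \<theta>\<eta> \<theta>C \<eta>C)
  then have "\<theta> \<in> iso (MR G) (MR H)"
    by (auto simp: iso_def hom_def MR_simps \<theta>C mult)
  then show ?thesis by (rule is_isoI)
qed

section \<open>The least nonzero ideal consists of the maps of rank one\<close>

definition collapse :: "'a set \<Rightarrow> 'a \<Rightarrow> 'a \<rightharpoonup> 'a" where
  "collapse \<sigma> b = (\<lambda>v. if v \<in> \<sigma> then Some b else None)"

lemma collapse_eq_empty_iff: "collapse \<sigma> b = Map.empty \<longleftrightarrow> \<sigma> = {}"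
  by (auto simp: collapse_def fun_eq_iff)

lemma simplex_nonempty: "simplex G \<sigma> \<Longrightarrow> \<sigma> \<noteq> {}"
  by (auto simp: simplex_def)

lemma collapse_MR_carrier:
  assumes "pair_wf_digraph G" "simplex G \<sigma>" "b \<in> pverts G"
  shows "collapse \<sigma> b \<in> MR_carrier G"
proof -
  have "preimage (collapse \<sigma> b) \<tau> = (if b \<in> \<tau> then \<sigma> else {})" for \<tau>
    by (auto simp: preimage_def collapse_def split: if_splits)
  with assms simplex_subset[OF assms(1,2)] show ?thesis
    by (auto simp: MR_carrier_def collapse_def ran_def dom_def split: if_splits)
qed

lemma empty_MR_carrier: "Map.empty \<in> MR_carrier G"
  by (simp add: MR_carrier_def preimage_def)

text \<open>
  The empty map is the zero of the monoid, so this is membership in every two-sided ideal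
  other than zero. It refers only to the multiplication and the zero, which makes it invariant
  under isomorphisms.
\<close>

definition in_least_ideal :: "('a \<rightharpoonup> 'a) set \<Rightarrow> ('a \<rightharpoonup> 'a) \<Rightarrow> bool" where
  "in_least_ideal M x \<longleftrightarrow>
    (\<forall>y \<in> M. y \<noteq> Map.empty \<longrightarrow> (\<exists>a \<in> M. \<exists>b \<in> M. x = b \<circ>\<^sub>m y \<circ>\<^sub>m a))"

text \<open>
  A nonempty \<open>y\<close> sends some \<open>v\<close> to some \<open>w\<close>; then the composite
  \<open>\<sigma> \<rightarrow> v \<rightarrow> w \<rightarrow> b\<close> through \<open>y\<close> is \<open>collapse \<sigma> b\<close>.
\<close>

lemma collapse_in_least_ideal:
  assumes G: "pair_wf_digraph G" and "simplex G \<sigma>" "b \<in> pverts G"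
  shows "in_least_ideal (MR_carrier G) (collapse \<sigma> b)"
  unfolding in_least_ideal_def
proof (intro ballI impI)
  fix y assume y: "y \<in> MR_carrier G" "y \<noteq> Map.empty"
  then obtain v w where vw: "y v = Some w" by (auto simp: fun_eq_iff)
  with y have V: "v \<in> pverts G" "w \<in> pverts G" by (auto simp: MR_carrier_def ran_def dom_def)
  then have "simplex G {w}" by (auto simp: simplex_def)
  then have "collapse \<sigma> v \<in> MR_carrier G" "collapse {w} b \<in> MR_carrier G"
    using collapse_MR_carrier[OF G assms(2) V(1)] collapse_MR_carrier[OF G _ assms(3)]
    by simp_all
  moreover have "collapse \<sigma> b = collapse {w} b \<circ>\<^sub>m y \<circ>\<^sub>m collapse \<sigma> v"
    using vw by (auto simp: collapse_def map_comp_def fun_eq_iff)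
  ultimately show "\<exists>a \<in> MR_carrier G. \<exists>c \<in> MR_carrier G. collapse \<sigma> b = c \<circ>\<^sub>m y \<circ>\<^sub>m a" by blast
qed

text \<open>
  As a member of the ideal generated by \<open>collapse {v} v\<close>, for some vertex \<open>v\<close>, the map \<open>x\<close> has
  only one value \<open>b\<close>; its domain is then the preimage of the simplex \<open>{b}\<close>.
\<close>

lemma least_ideal_collapse:
  assumes G: "pair_wf_digraph G" and x: "x \<in> MR_carrier G" "x \<noteq> Map.empty"
    and least: "in_least_ideal (MR_carrier G) x"
  obtains \<sigma> b where "simplex G \<sigma>" "b \<in> pverts G" "x = collapse \<sigma> b"
proof -
  from x obtain v b where vb: "x v = Some b" by (auto simp: fun_eq_iff)
  with x have v: "v \<in> pverts G" "b \<in> pverts G" by (auto simp: MR_carrier_def ran_def dom_def)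
  have "collapse {v} v \<in> MR_carrier G"
    using G v by (auto intro!: collapse_MR_carrier simp: simplex_def)
  then obtain a c where ac: "x = c \<circ>\<^sub>m collapse {v} v \<circ>\<^sub>m a"
    using least by (auto simp: in_least_ideal_def collapse_eq_empty_iff)
  have const: "x u = Some w \<Longrightarrow> c v = Some w" for u w
    unfolding ac by (auto simp: map_comp_def collapse_def split: option.splits if_splits)
  have only_b: "w = b" if "x u = Some w" for u w using const[OF that] const[OF vb] by simp
  have xc: "x = collapse (dom x) b"
    by (auto simp: collapse_def fun_eq_iff dom_def dest: only_b)
  have "preimage x {b} = dom x"
    by (subst (1 2) xc) (auto simp: preimage_def collapse_def split: if_splits)
  moreover have "simplex G {b}" using v by (auto simp: simplex_def)
  then have "simplex G (preimage x {b}) \<or> preimage x {b} = {}"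
    using x(1) by (simp add: MR_carrier_def)
  ultimately have "simplex G (dom x)" using vb by auto
  with xc show ?thesis using that v by blast
qed

section \<open>Monoid isomorphisms induce graph homomorphisms\<close>

lemma monoid_iso_set_sym:
  assumes G: "monoid G" and h: "h \<in> iso G H"
  shows "inv_into (carrier G) h \<in> iso H G"
proof -
  from h have hom: "h \<in> hom G H" and bij: "bij_betw h (carrier G) (carrier H)"
    by (auto simp: iso_def)
  note bij' = bij_betw_inv_into[OF bij]
  have "inv_into (carrier G) h (x \<otimes>\<^bsub>H\<^esub> y) = inv_into (carrier G) h x \<otimes>\<^bsub>G\<^esub> inv_into (carrier G) h y"
    if xy: "x \<in> carrier H" "y \<in> carrier H" for x y
  proof -
    obtain a b where ab: "a \<in> carrier G" "b \<in> carrier G" "x = h a" "y = h b"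
      using xy bij unfolding bij_betw_def by blast
    then have "x \<otimes>\<^bsub>H\<^esub> y = h (a \<otimes>\<^bsub>G\<^esub> b)" using hom by (simp add: hom_mult)
    then show ?thesis
      using ab bij monoid.m_closed[OF G] by (simp add: bij_betw_inv_into_left)
  qed
  with bij' show ?thesis by (auto simp: iso_def hom_def bij_betw_def)
qed

locale MR_isomorphism =
  fixes G :: "'a pair_pre_digraph" and H :: "'b pair_pre_digraph" and \<theta>
  assumes G: "pair_graph G" and H: "pair_graph H" and iso: "\<theta> \<in> iso (MR G) (MR H)"
begin

lemma wf_G: "pair_wf_digraph G" and wf_H: "pair_wf_digraph H"
  using G H by (simp_all add: pair_graph_def pair_digraph_def pair_fin_digraph_def)

lemma bij: "bij_betw \<theta> (MR_carrier G) (MR_carrier H)"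
  using iso by (simp add: iso_def MR_simps)

lemma \<theta>_carrier: "f \<in> MR_carrier G \<Longrightarrow> \<theta> f \<in> MR_carrier H"
  using bij by (auto simp: bij_betw_def)

lemma \<theta>_surj:
  assumes "g \<in> MR_carrier H"
  obtains f where "f \<in> MR_carrier G" "g = \<theta> f"
  using bij assms by (auto simp: bij_betw_def)

lemma \<theta>_mult:
  "f \<in> MR_carrier G \<Longrightarrow> g \<in> MR_carrier G \<Longrightarrow> \<theta> (g \<circ>\<^sub>m f) = \<theta> g \<circ>\<^sub>m \<theta> f"
  using iso by (auto simp: iso_def hom_def MR_simps)

lemma map_comp_carrier:
  "f \<in> MR_carrier G \<Longrightarrow> g \<in> MR_carrier G \<Longrightarrow> g \<circ>\<^sub>m f \<in> MR_carrier G"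
  using monoid.m_closed[OF monoid_MR[OF wf_G]] by (simp add: MR_simps)

text \<open>
  An isomorphism preserves the zero: if \<open>z\<close> is mapped to the zero of the target, then
  \<open>0 = z 0\<close> is mapped to a product with zero.
\<close>

lemma \<theta>_empty: "\<theta> Map.empty = Map.empty"
proof -
  obtain z where z: "z \<in> MR_carrier G" "Map.empty = \<theta> z"
    using \<theta>_surj[OF empty_MR_carrier] .
  have "\<theta> Map.empty = \<theta> (Map.empty \<circ>\<^sub>m z)"
    by (simp add: map_comp_def option.case_eq_if)
  also have "\<dots> = \<theta> Map.empty \<circ>\<^sub>m Map.empty"
    using \<theta>_mult[OF z(1) empty_MR_carrier] z(2) by simp
  finally show ?thesis by simp
qed

lemma \<theta>_eq_empty_iff:
  assumes "f \<in> MR_carrier G"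
  shows "\<theta> f = Map.empty \<longleftrightarrow> f = Map.empty"
  using assms bij \<theta>_empty empty_MR_carrier[of G] by (metis bij_betw_imp_inj_on inj_onD)

lemma \<theta>_least_ideal:
  assumes x: "x \<in> MR_carrier G" and least: "in_least_ideal (MR_carrier G) x"
  shows "in_least_ideal (MR_carrier H) (\<theta> x)"
  unfolding in_least_ideal_def
proof (intro ballI impI)
  fix y assume y: "y \<in> MR_carrier H" "y \<noteq> Map.empty"
  then obtain y' where y': "y' \<in> MR_carrier G" "y = \<theta> y'" using \<theta>_surj by blast
  with y have "y' \<noteq> Map.empty" using \<theta>_empty by blast
  then obtain a b where "a \<in> MR_carrier G" "b \<in> MR_carrier G" "x = b \<circ>\<^sub>m y' \<circ>\<^sub>m a"
    using least y' by (auto simp: in_least_ideal_def)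
  then have "\<theta> x = \<theta> b \<circ>\<^sub>m y \<circ>\<^sub>m \<theta> a"
    using y' by (simp add: \<theta>_mult map_comp_carrier)
  then show "\<exists>a \<in> MR_carrier H. \<exists>b \<in> MR_carrier H. \<theta> x = b \<circ>\<^sub>m y \<circ>\<^sub>m a"
    using \<open>a \<in> _\<close> \<open>b \<in> _\<close> \<theta>_carrier by blast
qed

lemma \<theta>_collapse:
  assumes "simplex G \<sigma>" "b \<in> pverts G"
  shows "\<exists>\<tau> c. simplex H \<tau> \<and> c \<in> pverts H \<and> \<theta> (collapse \<sigma> b) = collapse \<tau> c"
proof -
  have c: "collapse \<sigma> b \<in> MR_carrier G"
    using collapse_MR_carrier[OF wf_G assms] .
  then have "\<theta> (collapse \<sigma> b) \<noteq> Map.empty"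
    using simplex_nonempty[OF assms(1)] by (simp add: \<theta>_eq_empty_iff collapse_eq_empty_iff)
  with \<theta>_carrier[OF c] \<theta>_least_ideal[OF c collapse_in_least_ideal[OF wf_G assms]]
  show ?thesis using least_ideal_collapse[OF wf_H] by metis
qed

text \<open>
  The map \<open>\<phi>\<close> reads the vertex \<open>v\<close> as the idempotent \<open>collapse {v} v\<close> and takes the value of
  the image of this idempotent. Edges are preserved because a simplex of \<open>H\<close> that contains two
  distinct vertices consists of just these two.
\<close>

lemma injective_graph_hom:
  obtains \<phi> where "inj_on \<phi> (pverts G)" "\<phi> ` pverts G \<subseteq> pverts H"
    "map_prod \<phi> \<phi> ` parcs G \<subseteq> parcs H"
proof -
  have pt: "simplex G {v}" if "v \<in> pverts G" for v using that by (auto simp: simplex_def)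
  have "\<exists>c. c \<in> pverts H \<and> (\<exists>\<tau>. simplex H \<tau> \<and> \<theta> (collapse {v} v) = collapse \<tau> c)"
    if "v \<in> pverts G" for v
    using \<theta>_collapse[OF pt[OF that] that] by blast
  then obtain \<phi> where \<phi>V: "\<And>v. v \<in> pverts G \<Longrightarrow> \<phi> v \<in> pverts H"
    and \<phi>: "\<And>v. v \<in> pverts G \<Longrightarrow> \<exists>\<tau>. simplex H \<tau> \<and> \<theta> (collapse {v} v) = collapse \<tau> (\<phi> v)"
    by metis
  \<comment> \<open>Whether a product of two maps of rank one vanishes depends only on the incidence of the
     value of the first with the domain of the second.\<close>
  have incidence: "v \<in> \<sigma> \<longleftrightarrow> \<phi> v \<in> \<tau>"
    if v: "v \<in> pverts G" and \<sigma>: "simplex G \<sigma>" and b: "b \<in> pverts G"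
      and \<tau>: "\<theta> (collapse \<sigma> b) = collapse \<tau> c" for v \<sigma> b \<tau> c
  proof -
    obtain \<rho> where \<rho>: "simplex H \<rho>" "\<theta> (collapse {v} v) = collapse \<rho> (\<phi> v)" using \<phi>[OF v] by blast
    have comp_empty: "collapse A y \<circ>\<^sub>m collapse B x \<noteq> Map.empty \<longleftrightarrow> x \<in> A" if "B \<noteq> {}"
      for A B x y using that by (auto simp: collapse_def map_comp_def fun_eq_iff)
    have C: "collapse {v} v \<in> MR_carrier G" "collapse \<sigma> b \<in> MR_carrier G"
      using collapse_MR_carrier[OF wf_G pt[OF v] v] collapse_MR_carrier[OF wf_G \<sigma> b] by simp_all
    have "v \<in> \<sigma> \<longleftrightarrow> collapse \<sigma> b \<circ>\<^sub>m collapse {v} v \<noteq> Map.empty"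
      by (simp add: comp_empty)
    also have "\<dots> \<longleftrightarrow> \<theta> (collapse \<sigma> b \<circ>\<^sub>m collapse {v} v) \<noteq> Map.empty"
      using C by (simp add: \<theta>_eq_empty_iff map_comp_carrier)
    also have "\<theta> (collapse \<sigma> b \<circ>\<^sub>m collapse {v} v) = collapse \<tau> c \<circ>\<^sub>m collapse \<rho> (\<phi> v)"
      using C \<tau> \<rho> by (simp add: \<theta>_mult)
    also have "\<dots> \<noteq> Map.empty \<longleftrightarrow> \<phi> v \<in> \<tau>"
      using simplex_nonempty[OF \<rho>(1)] by (simp add: comp_empty)
    finally show ?thesis .
  qed
  have inj: "inj_on \<phi> (pverts G)"
  proof (rule inj_onI)
    fix u v assume uv: "u \<in> pverts G" "v \<in> pverts G" "\<phi> u = \<phi> v"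
    obtain \<tau> where \<tau>: "\<theta> (collapse {v} v) = collapse \<tau> (\<phi> v)" using \<phi>[OF uv(2)] by blast
    show "u = v"
      using incidence[OF uv(1) pt[OF uv(2)] uv(2) \<tau>] incidence[OF uv(2) pt[OF uv(2)] uv(2) \<tau>] uv(3)
      by simp
  qed
  have "(\<phi> u, \<phi> v) \<in> parcs H" if uv: "(u, v) \<in> parcs G" for u v
  proof -
    have "u \<noteq> v" using G uv unfolding pair_graph_def pair_digraph_def
      by (auto dest: pair_loopfree_digraph.pair_no_loops)
    have V: "u \<in> pverts G" "v \<in> pverts G"
      using wf_G uv by (auto dest: pair_wf_digraph.in_arcsD1 pair_wf_digraph.in_arcsD2)
    have \<sigma>: "simplex G {u, v}" using uv by (auto simp: simplex_def)
    obtain \<tau> c where \<tau>: "simplex H \<tau>" "\<theta> (collapse {u, v} u) = collapse \<tau> c"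
      using \<theta>_collapse[OF \<sigma> V(1)] by blast
    have "\<phi> u \<in> \<tau>" "\<phi> v \<in> \<tau>"
      using incidence[OF V(1) \<sigma> V(1) \<tau>(2)] incidence[OF V(2) \<sigma> V(1) \<tau>(2)] by simp_all
    moreover have "\<phi> u \<noteq> \<phi> v" using inj V \<open>u \<noteq> v\<close> by (auto dest: inj_onD)
    ultimately obtain x y where "(x, y) \<in> parcs H" "{\<phi> u, \<phi> v} = {x, y}"
      using \<tau>(1) by (auto simp: simplex_def)
    moreover have "(y, x) \<in> parcs H" if "(x, y) \<in> parcs H" for x y
      using H that by (metis pair_graph.axioms(2) pair_pseudo_graph.axioms(2)
          pair_sym_digraph.arcs_symmetric)
    ultimately show ?thesis by (auto simp: doubleton_eq_iff)
  qed
  then have "map_prod \<phi> \<phi> ` parcs G \<subseteq> parcs H" by auto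
  with inj \<phi>V show ?thesis using that by blast
qed

end

section \<open>The monoid determines the graph\<close>

text \<open>
  Comparing cardinalities of the vertex sets shows that \<open>\<phi>\<close> is onto, and comparing those of the
  arc sets that every arc of \<open>H\<close> is the image of an arc of \<open>G\<close>.
\<close>

lemma graph_iso_if_injective_homs:
  assumes G: "pair_fin_digraph G" and H: "pair_fin_digraph H"
    and \<phi>: "inj_on \<phi> (pverts G)" "\<phi> ` pverts G \<subseteq> pverts H"
      "map_prod \<phi> \<phi> ` parcs G \<subseteq> parcs H"
    and \<psi>: "inj_on \<psi> (pverts H)" "\<psi> ` pverts H \<subseteq> pverts G"
      "map_prod \<psi> \<psi> ` parcs H \<subseteq> parcs G"
  shows "bij_betw \<phi> (pverts G) (pverts H)"
    and "\<And>u v. u \<in> pverts G \<Longrightarrow> v \<in> pverts G \<Longrightarrow> (u, v) \<in> parcs G \<longleftrightarrow> (\<phi> u, \<phi> v) \<in> parcs H"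
proof -
  note fin = pair_fin_digraph.pair_finite_verts[OF G] pair_fin_digraph.pair_finite_verts[OF H]
    pair_fin_digraph.pair_finite_arcs[OF G] pair_fin_digraph.pair_finite_arcs[OF H]
  have sub: "parcs G \<subseteq> pverts G \<times> pverts G" "parcs H \<subseteq> pverts H \<times> pverts H"
    using G H unfolding pair_fin_digraph_def
    by (auto dest: pair_wf_digraph.in_arcsD1 pair_wf_digraph.in_arcsD2)
  have "card (pverts H) \<le> card (pverts G)" using \<psi> fin by (metis card_inj_on_le)
  then have "\<phi> ` pverts G = pverts H"
    using \<phi> fin by (metis card_image card_seteq)
  with \<phi>(1) show "bij_betw \<phi> (pverts G) (pverts H)" by (simp add: bij_betw_def)
  have injs: "inj_on (map_prod \<phi> \<phi>) (parcs G)" "inj_on (map_prod \<psi> \<psi>) (parcs H)"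
    using map_prod_inj_on[OF \<phi>(1) \<phi>(1)] map_prod_inj_on[OF \<psi>(1) \<psi>(1)] sub
    by (auto intro: inj_on_subset)
  have "card (parcs H) \<le> card (parcs G)" using injs(2) \<psi>(3) fin(3) by (rule card_inj_on_le)
  then have arcs: "map_prod \<phi> \<phi> ` parcs G = parcs H"
    using injs(1) \<phi>(3) fin(4) by (metis card_image card_seteq)
  fix u v assume uv: "u \<in> pverts G" "v \<in> pverts G"
  show "(u, v) \<in> parcs G \<longleftrightarrow> (\<phi> u, \<phi> v) \<in> parcs H"
  proof
    assume "(\<phi> u, \<phi> v) \<in> parcs H"
    then have "(\<phi> u, \<phi> v) \<in> map_prod \<phi> \<phi> ` parcs G" using arcs by simp
    then obtain x y where "(x, y) \<in> parcs G" "\<phi> u = \<phi> x" "\<phi> v = \<phi> y" by auto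
    then show "(u, v) \<in> parcs G" using uv sub(1) \<phi>(1) by (metis inj_onD mem_Sigma_iff subsetD)
  qed (use \<phi>(3) in force)
qed

theorem theorem19p2:
  fixes \<Gamma> :: "'a pair_pre_digraph" and \<Gamma>' :: "'b pair_pre_digraph"
  assumes "pair_graph \<Gamma>" and "pair_graph \<Gamma>'"
  shows "digraph_iso (with_proj \<Gamma>) (with_proj \<Gamma>') \<longleftrightarrow> MR \<Gamma> \<cong> MR \<Gamma>'"
proof -
  have fin: "pair_fin_digraph \<Gamma>" "pair_fin_digraph \<Gamma>'"
    using assms by (simp_all add: pair_graph_def pair_digraph_def)
  then have wf: "pair_wf_digraph \<Gamma>" "pair_wf_digraph \<Gamma>'"
    by (simp_all add: pair_fin_digraph_def)
  show ?thesis
  proof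
    assume "digraph_iso (with_proj \<Gamma>) (with_proj \<Gamma>')"
    then show "MR \<Gamma> \<cong> MR \<Gamma>'"
      unfolding digraph_iso_with_proj_iff[OF wf] using MR_iso_if_graph_iso[OF wf] by blast
  next
    assume "MR \<Gamma> \<cong> MR \<Gamma>'"
    then obtain \<theta> where "\<theta> \<in> iso (MR \<Gamma>) (MR \<Gamma>')" by (auto simp: is_iso_def)
    then interpret A: MR_isomorphism \<Gamma> \<Gamma>' \<theta> by (rule MR_isomorphism.intro[OF assms(1,2)])
    obtain \<eta> where "\<eta> \<in> iso (MR \<Gamma>') (MR \<Gamma>)"
      using A.iso monoid_iso_set_sym[OF monoid_MR[OF wf(1)]] by blast
    then interpret B: MR_isomorphism \<Gamma>' \<Gamma> \<eta> by (rule MR_isomorphism.intro[OF assms(2,1)])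
    obtain \<phi> where \<phi>: "inj_on \<phi> (pverts \<Gamma>)" "\<phi> ` pverts \<Gamma> \<subseteq> pverts \<Gamma>'"
      "map_prod \<phi> \<phi> ` parcs \<Gamma> \<subseteq> parcs \<Gamma>'"
      using A.injective_graph_hom .
    obtain \<psi> where \<psi>: "inj_on \<psi> (pverts \<Gamma>')" "\<psi> ` pverts \<Gamma>' \<subseteq> pverts \<Gamma>"
      "map_prod \<psi> \<psi> ` parcs \<Gamma>' \<subseteq> parcs \<Gamma>"
      using B.injective_graph_hom .
    show "digraph_iso (with_proj \<Gamma>) (with_proj \<Gamma>')"
      unfolding digraph_iso_with_proj_iff[OF wf]
      using graph_iso_if_injective_homs[OF fin \<phi> \<psi>] by (intro exI[of _ \<phi>]) simp
  qed
qed

end
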